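(* For any partition $\lambda$ we have $$x\,(|\lambda|+1)\,F_\lambda\,\mathrm{He}_\lambda(x)=\sum_{\gamma\,:\,\lambda\in T_1(\gamma)} F_\gamma\,\mathrm{He}_\gamma(x),$$ where the sum runs over all partitions $\gamma$ with $\lambda\in T_1(\gamma)$.
   Context: A partition $\lambda=(\lambda_1\ge\dots\ge\lambda_r>0)$ has length $r$ and size $|\lambda|=\sum_i\lambda_i$; $\varnothing$ is the partition of $0$. Set $\lambda_i=0$ for $i>r$. Partial order: $\mu\le\lambda$ iff $\mu_i\le\lambda_i$ for all $i$. For a partition $\gamma$ with $|\gamma|\ge1$, $T_1(\gamma)=\{\mu\le\gamma : |\mu|=|\gamma|-1\}$. $F_\lambda$ is the number of standard Young tableaux of shape $\lambda$ (with $F_\varnothing=1$). Hermite polynomials: $\mathrm{He}_0(x)=1$, $\mathrm{He}_1(x)=x$, $\mathrm{He}_n(x)=x\,\mathrm{He}_{n-1}(x)-(n-1)\,\mathrm{He}_{n-2}(x)$ for $n\ge2$. The degree sequence of $\lambda$ of length $r$ is $n_\lambda=(n_1,\dots,n_r)$ with $n_i=\lambda_i+r-i$, and $\Delta(n_\lambda)=\prod_{1\le i<j\le r}(n_j-n_i)$. The Wronskian is $\mathrm{Wr}[f_1,\dots,f_r]=\det\big(f_j^{(i-1)}\big)_{1\le i,j\le r}$. The Wronskian Hermite polynomial of $\lambda$ is $\mathrm{He}_\lambda=\mathrm{Wr}[\mathrm{He}_{n_1},\dots,\mathrm{He}_{n_r}]/\Delta(n_\lambda)$, with $\mathrm{He}_\varnothing=1$.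 *)

theory Defs
  imports "HOL-Computational_Algebra.Polynomial" "HOL-Library.FuncSet"
    "Jordan_Normal_Form.Determinant"
begin

text \<open>All indices are shifted to start at \<open>0\<close>.\<close>

definition is_partition :: "nat list \<Rightarrow> bool" where
  "is_partition lam \<longleftrightarrow> sorted_wrt (\<ge>) lam \<and> (\<forall>k\<in>set lam. 0 < k)"

definition part :: "nat list \<Rightarrow> nat \<Rightarrow> nat" where
  "part lam i = (if i < length lam then lam ! i else 0)"

definition part_le :: "nat list \<Rightarrow> nat list \<Rightarrow> bool" where
  "part_le mu lam \<longleftrightarrow> (\<forall>i. part mu i \<le> part lam i)"

text \<open>Writing the size condition with addition avoids truncated subtraction; in particular
  \<open>T1 []\<close> is empty.\<close>

definition T1 :: "nat list \<Rightarrow> nat list set" where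
  "T1 gam = {mu. is_partition mu \<and> part_le mu gam \<and> sum_list mu + 1 = sum_list gam}"

definition cells :: "nat list \<Rightarrow> (nat \<times> nat) set" where
  "cells lam = {(i, j). i < length lam \<and> j < lam ! i}"

text \<open>A tableau is pinned to \<open>undefined\<close> outside its diagram, so that distinct functions are
  distinct tableaux.\<close>

definition standard_tableaux :: "nat list \<Rightarrow> (nat \<times> nat \<Rightarrow> nat) set" where
  "standard_tableaux lam = {T \<in> extensional (cells lam).
     bij_betw T (cells lam) {1..sum_list lam} \<and>
     (\<forall>i j j'. (i, j) \<in> cells lam \<longrightarrow> (i, j') \<in> cells lam \<longrightarrow> j < j' \<longrightarrow> T (i, j) < T (i, j')) \<and>
     (\<forall>i i' j. (i, j) \<in> cells lam \<longrightarrow> (i', j) \<in> cells lam \<longrightarrow> i < i' \<longrightarrow> T (i, j) < T (i', j))}"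

definition num_SYT :: "nat list \<Rightarrow> nat" where
  "num_SYT lam = card (standard_tableaux lam)"

fun hermite :: "nat \<Rightarrow> real poly" where
  "hermite 0 = 1"
| "hermite (Suc 0) = [:0, 1:]"
| "hermite (Suc (Suc n)) = [:0, 1:] * hermite (Suc n) - of_nat (Suc n) * hermite n"

definition degree_seq :: "nat list \<Rightarrow> nat list" where
  "degree_seq lam = map (\<lambda>i. lam ! i + (length lam - Suc i)) [0..<length lam]"

definition vandermonde :: "nat list \<Rightarrow> real" where
  "vandermonde ns = (\<Prod>j<length ns. \<Prod>i<j. real (ns ! j) - real (ns ! i))"

definition wronskian :: "real poly list \<Rightarrow> real poly" where
  "wronskian fs = det (mat (length fs) (length fs) (\<lambda>(i, j). (pderiv ^^ i) (fs ! j)))"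

text \<open>For the empty partition the determinant and the product are both empty, which gives the
  value \<open>1\<close>.\<close>

definition wronskian_hermite :: "nat list \<Rightarrow> real poly" where
  "wronskian_hermite lam =
     smult (1 / vandermonde (degree_seq lam)) (wronskian (map hermite (degree_seq lam)))"

text \<open>A sum over an infinite set is \<open>0\<close> by convention; the following shows that the sum over all
  \<open>gam\<close> with \<open>lam \<in> T1 gam\<close> is a genuine one.\<close>

lemma finite_T1_preimage: "finite {gam. is_partition gam \<and> lam \<in> T1 gam}"
proof -
  let ?n = "sum_list lam + 1"
  have "length g \<le> sum_list g" if "\<forall>k\<in>set g. 0 < k" for g :: "nat list"
    using that by (induction g) auto
  then have "{gam. is_partition gam \<and> lam \<in> T1 gam}
      \<subseteq> {xs. set xs \<subseteq> {..?n} \<and> length xs \<le> ?n}"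
    by (auto simp: is_partition_def T1_def member_le_sum_list)
  then show ?thesis
    using finite_lists_length_le[of "{..?n}" ?n] finite_subset by blast
qed

end

theory Submission
  imports Defs
begin

text \<open>Put \<open>h\<^sub>k = He\<^sub>k / k!\<close>. Since \<open>h\<^sub>k' = h\<^bsub>k-1\<^esub>\<close>, the Wronskian of the \<open>He\<close> of the degree sequence is, up to
  factorials and the sign of the row reversal, the Jacobi--Trudi determinant \<open>s\<^sub>\<lambda>(h) = det (h\<^bsub>\<lambda>\<^sub>j - j + i\<^esub>)\<close>. In the
  same way the Vandermonde product is \<open>s\<^sub>\<lambda>(e)\<close> for \<open>e\<^sub>k = 1 / k!\<close>, with the same factorials and the same
  sign. Both the branching rule for standard tableaux (remove the largest entry) and \<open>k e\<^sub>k = e\<^bsub>k-1\<^esub>\<close> give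
  the same recursion, so \<open>F\<^sub>\<lambda> = |\<lambda>|! s\<^sub>\<lambda>(e)\<close>. Hence \<open>F\<^sub>\<lambda> He\<^sub>\<lambda> = |\<lambda>|! s\<^sub>\<lambda>(h)\<close>, and the claim is the
  Pieri rule \<open>h\<^sub>1 s\<^sub>\<lambda> = \<Sum> s\<^sub>\<gamma>\<close>, valid for every sequence \<open>h\<close> with \<open>h\<^sub>0 = 1\<close> and \<open>h\<^sub>k = 0\<close> for \<open>k < 0\<close>,
  because \<open>h\<^sub>1 = x\<close>.\<close>

section \<open>Determinants\<close>

text \<open>The cofactor at \<open>(i, j)\<close> does not see row \<open>i\<close> or column
  \<open>j\<close>, so a matrix altered only in that row or column keeps the cofactors used when
  expanding along it.\<close>

lemma cofactor_cong:
  assumes "dim_row A = dim_row B" "dim_col A = dim_col B"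
    and "\<And>r s. r < dim_row B \<Longrightarrow> s < dim_col B \<Longrightarrow> r \<noteq> i \<Longrightarrow> s \<noteq> j \<Longrightarrow> A $$ (r, s) = B $$ (r, s)"
  shows "cofactor A i j = cofactor B i j"
proof -
  have "mat_delete A i j = mat_delete B i j"
    unfolding mat_delete_def using assms by (intro eq_matI) auto
  then show ?thesis
    by (simp add: cofactor_def)
qed

text \<open>Both sides are the derivative at \<open>t = 0\<close> of the determinant of \<open>M + t N\<close>.\<close>

lemma sum_det_replace_col_eq_replace_row:
  fixes M N :: "nat \<Rightarrow> nat \<Rightarrow> 'a :: comm_ring_1"
  shows "(\<Sum>k<m. det (mat m m (\<lambda>(i, j). if j = k then N i j else M i j)))
       = (\<Sum>k<m. det (mat m m (\<lambda>(i, j). if i = k then N i j else M i j)))"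
proof -
  let ?M = "mat m m (\<lambda>(i, j). M i j)"
  have col: "det (mat m m (\<lambda>(i, j). if j = k then N i j else M i j)) = (\<Sum>i<m. N i k * cofactor ?M i k)"
    if "k < m" for k
    using that
    by (subst laplace_expansion_column[of _ m k]) (auto intro!: sum.cong arg_cong2[where f = "(*)"] cofactor_cong)
  have row: "det (mat m m (\<lambda>(i, j). if i = k then N i j else M i j)) = (\<Sum>j<m. N k j * cofactor ?M k j)"
    if "k < m" for k
    using that
    by (subst laplace_expansion_row[of _ m k]) (auto intro!: sum.cong arg_cong2[where f = "(*)"] cofactor_cong)
  show ?thesis
    \<comment> \<open>Both sides are now the double sum of \<open>N i j * cofactor ?M i j\<close>,
      in opposite orders of summation.\<close>
    using sum.swap[of "\<lambda>k i. N i k * cofactor ?M i k" "{..<m}" "{..<m}"] by (simp add: col row)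
qed

lemma det_mat_scale_cols:
  fixes c :: "nat \<Rightarrow> 'a :: comm_ring_1"
  shows "det (mat m m (\<lambda>(i, j). c j * M i j)) = (\<Prod>j<m. c j) * det (mat m m (\<lambda>(i, j). M i j))"
proof -
  let ?D = "mat m m (\<lambda>(i, j). if i = j then c j else 0)"
  have "mat m m (\<lambda>(i, j). c j * M i j) = mat m m (\<lambda>(i, j). M i j) * ?D"
  proof (rule eq_matI)
    fix i j assume "i < dim_row (mat m m (\<lambda>(i, j). M i j) * ?D)" "j < dim_col (mat m m (\<lambda>(i, j). M i j) * ?D)"
    then show "mat m m (\<lambda>(i, j). c j * M i j) $$ (i, j) = (mat m m (\<lambda>(i, j). M i j) * ?D) $$ (i, j)"
      by (simp add: scalar_prod_def mult_ac if_distrib[of "\<lambda>x. _ * x"] cong: if_cong)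
  qed auto
  moreover have "det ?D = (\<Prod>j<m. c j)"
    by (subst det_lower_triangular[of m])
      (auto simp: prod_list_diag_prod lessThan_atLeast0)
  ultimately show ?thesis
    by (simp add: det_mult[of _ m] mult.commute)
qed

lemma det_mat_replace_col_scale:
  fixes c :: "'a :: comm_ring_1"
  assumes "k < m"
  shows "det (mat m m (\<lambda>(i, j). if j = k then c * M i j else M i j)) = c * det (mat m m (\<lambda>(i, j). M i j))"
proof -
  have "det (mat m m (\<lambda>(i, j). if j = k then c * M i j else M i j))
      = det (mat m m (\<lambda>(i, j). (if j = k then c else 1) * M i j))"
    by (intro arg_cong[of _ _ det]) auto
  then show ?thesis
    using assms by (simp only: det_mat_scale_cols) (simp add: prod.delta)
qed

lemma det_mat_replace_row_scale:
  fixes c :: "'a :: comm_ring_1"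
  assumes "k < m"
  shows "det (mat m m (\<lambda>(i, j). if i = k then c * M i j else M i j)) = c * det (mat m m (\<lambda>(i, j). M i j))"
proof -
  have "det (mat m m (\<lambda>(i, j). if i = k then c * M i j else M i j))
      = det (transpose_mat (mat m m (\<lambda>(i, j). if i = k then c * M i j else M i j)))"
    by (subst det_transpose) auto
  also have "transpose_mat (mat m m (\<lambda>(i, j). if i = k then c * M i j else M i j))
      = mat m m (\<lambda>(i, j). if j = k then c * M j i else M j i)"
    by (intro eq_matI) auto
  also have "det \<dots> = c * det (mat m m (\<lambda>(i, j). M j i))"
    using assms by (rule det_mat_replace_col_scale)
  also have "mat m m (\<lambda>(i, j). M j i) = transpose_mat (mat m m (\<lambda>(i, j). M i j))"
    by (intro eq_matI) auto
  also have "det \<dots> = det (mat m m (\<lambda>(i, j). M i j))"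
    by (subst det_transpose) auto
  finally show ?thesis .
qed

text \<open>With zero divisors the degree of a product may drop; carrying the leading coefficient
  \<open>1\<close> through the same induction excludes this.\<close>

lemma monic_prod_linear:
  fixes x :: "nat \<Rightarrow> 'a :: comm_ring_1"
  shows "degree (\<Prod>k<i. [:- x k, 1:]) = i" "coeff (\<Prod>k<i. [:- x k, 1:]) i = 1"
proof -
  have "degree (\<Prod>k<i. [:- x k, 1:]) = i \<and> coeff (\<Prod>k<i. [:- x k, 1:]) i = 1"
  proof (induction i)
    case (Suc i)
    define N where "N = (\<Prod>k<i. [:- x k, 1:])"
    define L where "L = [:- x i, 1:]"
    have N: "degree N = i" "coeff N i = 1" and L: "degree L = 1" "coeff L 1 = 1"
      using Suc by (auto simp: N_def L_def)
    have "coeff (N * L) (Suc i) = 1"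
      using coeff_mult_degree_sum[of N L] N L by simp
    moreover from this have "degree (N * L) = Suc i"
      using degree_mult_le[of N L] le_degree[of "N * L" "Suc i"] N L by simp
    ultimately show ?case
      by (simp only: prod.lessThan_Suc N_def L_def)
  qed simp
  then show "degree (\<Prod>k<i. [:- x k, 1:]) = i" "coeff (\<Prod>k<i. [:- x k, 1:]) i = 1" by auto
qed

text \<open>Unitriangular row operations turn the \<open>p i\<close> into the Newton polynomials at
  the nodes \<open>x k\<close>, whose matrix of values is triangular.\<close>

lemma det_mat_monic_polys:
  fixes p :: "nat \<Rightarrow> 'a :: comm_ring_1 poly"
  assumes p: "\<And>i. degree (p i) = i" "\<And>i. lead_coeff (p i) = 1"
  shows "det (mat m m (\<lambda>(i, j). poly (p i) (x j))) = (\<Prod>j<m. \<Prod>i<j. x j - x i)"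
proof -
  \<comment> \<open>The polynomials \<open>p 0\<close>, ..., \<open>p (n - 1)\<close> span
    everything of degree below \<open>n\<close>: a multiple of \<open>p n\<close> strips the top
    coefficient.\<close>
  have expand: "\<exists>c. q = (\<Sum>k<n. smult (c k) (p k))" if "\<And>i. n \<le> i \<Longrightarrow> coeff q i = 0" for n and q :: "'a poly"
    using that
  proof (induction n arbitrary: q)
    case 0
    then show ?case by (auto simp: poly_eq_iff)
  next
    case (Suc n)
    have "coeff (q - smult (coeff q n) (p n)) i = 0" if "n \<le> i" for i
    proof (cases "i = n")
      case True
      then show ?thesis using p(2)[of n] p(1)[of n] by simp
    next
      case False
      then show ?thesis
        using Suc.prems[of i] that p(1)[of n] coeff_eq_0[of "p n" i] by simp
    qed
    then obtain c where "q - smult (coeff q n) (p n) = (\<Sum>k<n. smult (c k) (p k))"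
      using Suc.IH by blast
    then have "q = (\<Sum>k<Suc n. smult ((c(n := coeff q n)) k) (p k))"
      by (simp add: algebra_simps)
    then show ?case by blast
  qed
  \<comment> \<open>\<open>N i\<close> vanishes at \<open>x j\<close> for all \<open>j < i\<close>,
    which makes \<open>?N\<close> upper triangular.\<close>
  define N where "N = (\<lambda>i. \<Prod>k<i. [:- x k, 1:])"
  have N: "degree (N i) = i" "coeff (N i) i = 1" for i
    using monic_prod_linear[of x i] by (simp_all add: N_def)
  \<comment> \<open>Both polynomials are monic of degree \<open>i\<close>, so the difference has
    lower degree and \<open>expand\<close> applies.\<close>
  have "\<exists>c. N i - p i = (\<Sum>k<i. smult (c k) (p k))" for i
  proof (rule expand)
    fix l assume "i \<le> l"
    then show "coeff (N i - p i) l = 0"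
      using N[of i] p(1,2)[of i] coeff_eq_0[of "N i" l] coeff_eq_0[of "p i" l] by (cases "l = i") auto
  qed
  then obtain c where "\<And>i. N i - p i = (\<Sum>k<i. smult (c i k) (p k))"
    by metis
  then have c: "N i = p i + (\<Sum>k<i. smult (c i k) (p k))" for i
    by (metis add.commute diff_add_cancel)
  define U where "U = mat m m (\<lambda>(i, k). if k < i then c i k else if k = i then 1 else 0)"
  let ?P = "mat m m (\<lambda>(i, j). poly (p i) (x j))"
  let ?N = "mat m m (\<lambda>(i, j). poly (N i) (x j))"
  have "?N = U * ?P"
  proof (rule eq_matI)
    fix i j assume "i < dim_row (U * ?P)" "j < dim_col (U * ?P)"
    then have ij: "i < m" "j < m" by (auto simp: U_def)
    have "(U * ?P) $$ (i, j) = (\<Sum>k<m. (if k < i then c i k else if k = i then 1 else 0) * poly (p k) (x j))"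
      using ij by (simp add: U_def scalar_prod_def lessThan_atLeast0)
    also have "\<dots> = (\<Sum>k<Suc i. (if k < i then c i k else if k = i then 1 else 0) * poly (p k) (x j))"
      using ij by (intro sum.mono_neutral_right) auto
    also have "\<dots> = poly (N i) (x j)"
      unfolding c[of i] by (simp add: poly_sum)
    finally show "?N $$ (i, j) = (U * ?P) $$ (i, j)"
      using ij by simp
  qed (auto simp: U_def)
  moreover have "det U = 1"
    by (subst det_lower_triangular[of m]) (auto simp: U_def prod_list_diag_prod)
  ultimately have "det ?P = det ?N"
    by (simp add: det_mult[of _ m] U_def)
  also have "\<dots> = prod_list (diag_mat ?N)"
  proof (rule det_upper_triangular[of _ m])
    have "(\<Prod>k<i. x j - x k) = 0" if "j < i" for i j
      using that by (intro prod_zero bexI[of _ j]) auto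
    then show "upper_triangular ?N"
      by (auto simp: N_def poly_prod)
  qed simp
  also have "\<dots> = (\<Prod>j<m. \<Prod>i<j. x j - x i)"
    by (simp add: prod_list_diag_prod lessThan_atLeast0 N_def poly_prod)
  finally show ?thesis .
qed

text \<open>The identity outside \<open>{0..<m}\<close>, as \<open>permutes\<close> demands. Its
  sign is never evaluated, since it cancels between Wronskian and Vandermonde.\<close>

definition rev_rows :: "nat \<Rightarrow> nat \<Rightarrow> nat" where
  "rev_rows m i = (if i < m then m - Suc i else i)"

lemma det_mat_reverse_rows:
  fixes M :: "nat \<Rightarrow> nat \<Rightarrow> 'a :: comm_ring_1"
  shows "det (mat m m (\<lambda>(i, j). M (m - Suc i) j)) = of_int (sign (rev_rows m)) * det (mat m m (\<lambda>(i, j). M i j))"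
proof -
  let ?A = "mat m m (\<lambda>(i, j). M i j)"
  have "bij_betw (rev_rows m) {0..<m} {0..<m}"
    by (rule bij_betw_byWitness[where f' = "rev_rows m"]) (auto simp: rev_rows_def)
  then have "rev_rows m permutes {0..<m}"
    by (rule bij_imp_permutes) (simp add: rev_rows_def)
  then have "det (mat m m (\<lambda>(i, j). ?A $$ (rev_rows m i, j))) = of_int (sign (rev_rows m)) * det ?A"
    by (intro det_permute_rows) auto
  moreover have "mat m m (\<lambda>(i, j). ?A $$ (rev_rows m i, j)) = mat m m (\<lambda>(i, j). M (m - Suc i) j)"
    by (intro eq_matI) (auto simp: rev_rows_def)
  ultimately show ?thesis by simp
qed

section \<open>Jacobi--Trudi determinants\<close>

text \<open>The transpose of the usual Jacobi-Trudi matrix. Size and shape are free parameters, so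
  shapes that fail to be partitions after a change in one row are allowed.\<close>

definition jacobi_trudi :: "(int \<Rightarrow> 'a :: comm_ring_1) \<Rightarrow> nat \<Rightarrow> (nat \<Rightarrow> nat) \<Rightarrow> 'a" where
  "jacobi_trudi h m p = det (mat m m (\<lambda>(i, j). h (int (p j) - int j + int i)))"

text \<open>Two columns coincide. This kills the terms in which adding or removing a box does not
  give a partition.\<close>

lemma jacobi_trudi_eq_0:
  assumes "i < m" "j < m" "i \<noteq> j" and "int (p i) - int i = int (p j) - int j"
  shows "jacobi_trudi h m p = 0"
proof -
  let ?A = "mat m m (\<lambda>(i, j). h (int (p j) - int j + int i))"
  have "col ?A i = col ?A j"
    using assms by (intro eq_vecI) auto
  then show ?thesis
    unfolding jacobi_trudi_def using assms by (intro det_identical_columns[of ?A m i j]) auto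
qed

text \<open>As \<open>p m = 0\<close>, the last column holds \<open>h (i - m)\<close>: zero above
  the diagonal and \<open>h 0\<close> on it.\<close>

lemma jacobi_trudi_Suc:
  assumes "\<And>k. k < 0 \<Longrightarrow> h k = 0" "p m = 0"
  shows "jacobi_trudi h (Suc m) p = h 0 * jacobi_trudi h m p"
proof -
  let ?A = "mat (Suc m) (Suc m) (\<lambda>(i, j). h (int (p j) - int j + int i))"
  have "mat_delete ?A m m = mat m m (\<lambda>(i, j). h (int (p j) - int j + int i))"
    unfolding mat_delete_def by (intro eq_matI) auto
  then have "cofactor ?A m m = jacobi_trudi h m p"
    by (simp add: cofactor_def jacobi_trudi_def)
  moreover have "det ?A = (\<Sum>i<Suc m. ?A $$ (i, m) * cofactor ?A i m)"
    by (rule laplace_expansion_column) auto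
  moreover have "?A $$ (i, m) = 0" if "i < m" for i
    using that assms by auto
  ultimately show ?thesis
    using assms by (simp add: jacobi_trudi_def)
qed

text \<open>Lets partitions of different lengths be compared at one determinant size.\<close>

lemma jacobi_trudi_pad:
  assumes "\<And>k. k < 0 \<Longrightarrow> h k = 0" "h 0 = 1" "m \<le> n" "\<And>j. m \<le> j \<Longrightarrow> j < n \<Longrightarrow> p j = 0"
  shows "jacobi_trudi h n p = jacobi_trudi h m p"
  using \<open>m \<le> n\<close> assms(4)
proof (induction n rule: dec_induct)
  case (step n)
  then show ?case
    using jacobi_trudi_Suc[of h p n] assms(1,2) by simp
qed auto

text \<open>Shifting every column of the Jacobi--Trudi matrix shifts its rows by one; only the last row
  is not already present in the matrix.\<close>

lemma pieri_jacobi_trudi: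
  assumes neg: "\<And>k. k < 0 \<Longrightarrow> h k = 0" and "p m = 0"
  shows "(\<Sum>k<Suc m. jacobi_trudi h (Suc m) (p(k := p k + 1))) = h 1 * jacobi_trudi h m p"
proof -
  let ?M = "\<lambda>i j. h (int (p j) - int j + int i)"
  let ?N = "\<lambda>i j. h (int (p j) - int j + int (Suc i))"
  let ?R = "\<lambda>k. mat (Suc m) (Suc m) (\<lambda>(i, j). if i = k then ?N i j else ?M i j)"
  have "jacobi_trudi h (Suc m) (p(k := p k + 1))
      = det (mat (Suc m) (Suc m) (\<lambda>(i, j). if j = k then ?N i j else ?M i j))" for k
    unfolding jacobi_trudi_def by (intro arg_cong[of _ _ det] eq_matI) (auto simp: algebra_simps)
  then have "(\<Sum>k<Suc m. jacobi_trudi h (Suc m) (p(k := p k + 1))) = (\<Sum>k<Suc m. det (?R k))"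
    by (simp only: sum_det_replace_col_eq_replace_row)
  also have "\<dots> = det (?R m)"
  proof -
    have "det (?R k) = 0" if "k < m" for k
    proof (rule det_identical_rows[of _ "Suc m" k "Suc k"])
      show "row (?R k) k = row (?R k) (Suc k)"
        using that by (intro eq_vecI) auto
    qed (use that in auto)
    then show ?thesis by simp
  qed
  also have "\<dots> = (\<Sum>i<Suc m. ?R m $$ (i, m) * cofactor (?R m) i m)"
    by (rule laplace_expansion_column) auto
  \<comment> \<open>In the last column the entries above the bottom are
    \<open>h (i - m) = 0\<close>; the shifted bottom entry is \<open>h 1\<close>.\<close>
  also have "\<dots> = h 1 * cofactor (?R m) m m"
    using assms by simp
  also have "cofactor (?R m) m m = jacobi_trudi h m p"
  proof -
    have "mat_delete (?R m) m m = mat m m (\<lambda>(i, j). ?M i j)"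
      unfolding mat_delete_def by (intro eq_matI) auto
    then show ?thesis
      by (simp add: cofactor_def jacobi_trudi_def)
  qed
  finally show ?thesis .
qed

text \<open>Column scaling by \<open>p j - j\<close> and row scaling by \<open>i\<close> combine, entrywise, to the scaling by
  the argument of \<open>e\<close>.\<close>

lemma jacobi_trudi_decrement:
  fixes e :: "int \<Rightarrow> 'a :: comm_ring_1"
  assumes e: "\<And>k. of_int k * e k = e (k - 1)" and pos: "\<And>j. j < m \<Longrightarrow> 0 < p j"
  shows "(\<Sum>k<m. jacobi_trudi e m (p(k := p k - 1))) = of_nat (\<Sum>j<m. p j) * jacobi_trudi e m p"
proof -
  let ?M = "\<lambda>i j. e (int (p j) - int j + int i)"
  let ?N = "\<lambda>i j. of_nat i * ?M i j"
  let ?A = "mat m m (\<lambda>(i, j). ?M i j)"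
  let ?B = "\<lambda>k. mat m m (\<lambda>(i, j). if j = k then ?N i j else ?M i j)"
  \<comment> \<open>With \<open>a = p k - k + i\<close>, the rule \<open>e (a - 1) = a * e a\<close>
    splits the lowered column \<open>k\<close> into \<open>p k - k\<close> times the old column plus
    the old column scaled entrywise by \<open>i\<close>.\<close>
  have *: "jacobi_trudi e m (p(k := p k - 1)) = of_int (int (p k) - int k) * det ?A + det (?B k)"
    if k: "k < m" for k
  proof -
    let ?C = "mat m m (\<lambda>(i, j). if j = k then e (int (p j) - int j + int i - 1) else ?M i j)"
    have "jacobi_trudi e m (p(k := p k - 1)) = det ?C"
      unfolding jacobi_trudi_def using pos[OF k]
      by (intro arg_cong[of _ _ det] eq_matI) (auto simp: algebra_simps of_nat_diff)
    also have "\<dots> = (\<Sum>i<m. ?C $$ (i, k) * cofactor ?C i k)"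
      using k by (intro laplace_expansion_column) auto
    also have "\<dots> = (\<Sum>i<m. of_int (int (p k) - int k) * (?A $$ (i, k) * cofactor ?A i k)
                        + ?B k $$ (i, k) * cofactor (?B k) i k)"
    proof (rule sum.cong[OF refl])
      fix i assume i: "i \<in> {..<m}"
      have cof: "cofactor ?C i k = cofactor ?A i k" "cofactor (?B k) i k = cofactor ?A i k"
        by (intro cofactor_cong; auto)+
      have "e (int (p k) - int k + int i - 1) = of_int (int (p k) - int k + int i) * ?M i k"
        by (simp only: e)
      then have "?C $$ (i, k) = of_int (int (p k) - int k) * ?A $$ (i, k) + ?B k $$ (i, k)"
        using i k by (simp add: algebra_simps)
      then show "?C $$ (i, k) * cofactor ?C i k = of_int (int (p k) - int k) * (?A $$ (i, k) * cofactor ?A i k)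
          + ?B k $$ (i, k) * cofactor (?B k) i k"
        by (simp only: cof distrib_right mult.assoc)
    qed
    also have "\<dots> = of_int (int (p k) - int k) * (\<Sum>i<m. ?A $$ (i, k) * cofactor ?A i k)
                   + (\<Sum>i<m. ?B k $$ (i, k) * cofactor (?B k) i k)"
      by (simp only: sum.distrib sum_distrib_left)
    also have "\<dots> = of_int (int (p k) - int k) * det ?A + det (?B k)"
      using k laplace_expansion_column[of ?A m k] laplace_expansion_column[of "?B k" m k] by auto
    finally show ?thesis .
  qed
  \<comment> \<open>After trading columns for rows, each term scales the single row \<open>k\<close>
    by \<open>k\<close>; the result cancels the \<open>- k\<close> of the column
    contribution.\<close>
  have "(\<Sum>k<m. det (?B k)) = (\<Sum>k<m. of_nat k * det ?A)"
    unfolding sum_det_replace_col_eq_replace_row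
  proof (rule sum.cong[OF refl])
    fix k assume "k \<in> {..<m}"
    then have "det (mat m m (\<lambda>(i, j). if i = k then of_nat k * ?M i j else ?M i j)) = of_nat k * det ?A"
      using det_mat_replace_row_scale by auto
    moreover have "mat m m (\<lambda>(i, j). if i = k then ?N i j else ?M i j)
        = mat m m (\<lambda>(i, j). if i = k then of_nat k * ?M i j else ?M i j)"
      by (intro eq_matI) auto
    ultimately show "det (mat m m (\<lambda>(i, j). if i = k then ?N i j else ?M i j)) = of_nat k * det ?A"
      by simp
  qed
  then have "(\<Sum>k<m. jacobi_trudi e m (p(k := p k - 1)))
      = (\<Sum>k<m. of_int (int (p k) - int k) * det ?A + of_nat k * det ?A)"
    using * by (simp add: sum.distrib)
  also have "\<dots> = of_nat (\<Sum>j<m. p j) * det ?A"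
    by (simp add: sum_distrib_right algebra_simps)
  finally show ?thesis
    by (simp add: jacobi_trudi_def)
qed

section \<open>Partitions and covers\<close>

lemma part_antimono:
  assumes "is_partition lam" "i \<le> j"
  shows "part lam j \<le> part lam i"
proof (cases "i < j \<and> j < length lam")
  case True
  then show ?thesis
    using assms sorted_wrt_nth_less[of "(\<ge>)" lam i j] by (auto simp: is_partition_def part_def)
next
  case False
  then show ?thesis
    using assms by (cases "i = j") (auto simp: part_def)
qed

lemma part_pos_iff:
  assumes "is_partition lam"
  shows "0 < part lam i \<longleftrightarrow> i < length lam"
  using assms by (auto simp: is_partition_def part_def)

lemma part_eq_0 [simp]: "length lam \<le> i \<Longrightarrow> part lam i = 0"
  by (simp add: part_def)

lemma part_inject:
  assumes "is_partition lam" "is_partition mu" "part lam = part mu"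
  shows "lam = mu"
proof -
  have "i < length lam \<longleftrightarrow> i < length mu" for i
    using assms part_pos_iff by metis
  then have "length lam = length mu"
    by (metis linorder_neq_iff)
  moreover have "lam ! i = mu ! i" if "i < length lam" for i
    using fun_cong[OF assms(3), of i] that calculation by (simp add: part_def)
  ultimately show ?thesis
    by (rule nth_equalityI)
qed

lemma sum_list_eq_sum_part:
  assumes "length lam \<le> m"
  shows "sum_list lam = (\<Sum>j<m. part lam j)"
proof -
  have "sum_list lam = (\<Sum>j<length lam. part lam j)"
    by (simp add: sum_list_sum_nth part_def lessThan_atLeast0)
  also have "\<dots> = (\<Sum>j<m. part lam j)"
    using assms by (intro sum.mono_neutral_left) auto
  finally show ?thesis .
qed

text \<open>The inverse of \<open>part\<close> on weakly decreasing functions that reach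
  \<open>0\<close>; cutting at the first zero keeps all entries positive.\<close>

definition part_list :: "(nat \<Rightarrow> nat) \<Rightarrow> nat list" where
  "part_list p = map p [0..<(LEAST m. p m = 0)]"

lemma part_list:
  assumes "\<And>i. p (Suc i) \<le> p i" "p m = 0"
  shows "is_partition (part_list p)" "part (part_list p) = p"
proof -
  have anti: "p j \<le> p i" if "i \<le> j" for i j
    using lift_Suc_antimono_le[of p i j] assms(1) that by simp
  define l where "l = (LEAST m. p m = 0)"
  have l: "p l = 0"
    unfolding l_def using assms(2) by (rule LeastI)
  have l': "0 < p i" if "i < l" for i
    using not_less_Least[of i "\<lambda>m. p m = 0"] that by (simp add: l_def)
  show "is_partition (part_list p)"
    using anti l' by (auto simp: is_partition_def part_list_def l_def[symmetric] sorted_wrt_iff_nth_less)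
  show "part (part_list p) = p"
    using anti[of l] l by (fastforce simp: part_def part_list_def l_def[symmetric] fun_eq_iff)
qed

lemma part_list_part:
  assumes "is_partition lam"
  shows "part_list (part lam) = lam"
  using assms part_list[of "part lam" "length lam"] part_antimono[OF assms]
  by (intro part_inject) auto

text \<open>The row differences are nonnegative and add up to \<open>1\<close>, so exactly one row
  differs, by one box.\<close>

lemma mem_T1_iff:
  assumes "is_partition gam"
  shows "lam \<in> T1 gam \<longleftrightarrow> is_partition lam \<and> (\<exists>k. part gam = (part lam)(k := part lam k + 1))"
proof (cases "is_partition lam")
  case True
  define m where "m = max (length lam) (length gam)"
  have sums: "sum_list lam = (\<Sum>j<m. part lam j)" "sum_list gam = (\<Sum>j<m. part gam j)"
    by (auto simp: m_def intro!: sum_list_eq_sum_part)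
  have "\<exists>k. part gam = (part lam)(k := part lam k + 1)"
    if le: "\<And>i. part lam i \<le> part gam i" and sum: "sum_list lam + 1 = sum_list gam"
  proof -
    have "\<exists>k<m. part lam k < part gam k"
    proof (rule ccontr)
      assume "\<not> ?thesis"
      then have "(\<Sum>j<m. part gam j) \<le> (\<Sum>j<m. part lam j)"
        by (intro sum_mono) force
      then show False
        using sum sums by simp
    qed
    then obtain k where k: "k < m" "part lam k < part gam k"
      by blast
    have split: "(\<Sum>j<m. f j) = f k + sum f ({..<m} - {k})" for f :: "nat \<Rightarrow> nat"
      using k by (simp add: sum.remove)
    have rest: "sum (part lam) ({..<m} - {k}) \<le> sum (part gam) ({..<m} - {k})"
      by (intro sum_mono le)
    \<comment> \<open>Row \<open>k\<close> already uses the whole surplus of \<open>1\<close>, so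
      the remaining rows have equal sums and, being comparable, are equal.\<close>
    have eqs: "part gam k = part lam k + 1" "sum (part lam) ({..<m} - {k}) = sum (part gam) ({..<m} - {k})"
      using split[of "part lam"] split[of "part gam"] rest k sum sums by linarith+
    have "part gam j = part lam j" if "j \<noteq> k" for j
    proof (cases "j < m")
      case True
      then show ?thesis
        using sum_mono_inv[OF eqs(2), of j] le that by auto
    qed (auto simp: m_def)
    then show ?thesis
      using eqs(1) by (intro exI[of _ k]) auto
  qed
  moreover have "(\<forall>i. part lam i \<le> part gam i) \<and> sum_list lam + 1 = sum_list gam"
    if k: "part gam = (part lam)(k := part lam k + 1)" for k
  proof -
    have "0 < part gam k"
      using k by simp
    then have "k < m"
      using part_pos_iff[OF assms] by (simp add: m_def)
    then have "(\<Sum>j<m. f j) = f k + sum f ({..<m} - {k})" for f :: "nat \<Rightarrow> nat"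
      by (simp add: sum.remove)
    from this[of "part lam"] this[of "part gam"] show ?thesis
      unfolding sums using k by simp
  qed
  ultimately show ?thesis
    using True by (auto simp: T1_def part_le_def)
qed (auto simp: T1_def)

text \<open>For a cover this row is unique; it supplies the inverse map in both bijections
  below.\<close>

definition changed_row :: "nat list \<Rightarrow> nat list \<Rightarrow> nat" where
  "changed_row lam gam = (THE k. part gam k \<noteq> part lam k)"

lemma changed_row_eq:
  assumes "part gam = (part lam)(k := part lam k + 1)"
  shows "changed_row lam gam = k"
  unfolding changed_row_def using assms by (intro the_equality) (auto split: if_splits)

text \<open>A box fits in the first row or in a row strictly shorter than the one above. The bound
  \<open>Suc (length lam)\<close> admits a new row at the bottom.\<close>

lemma bij_betw_addable_rows:
  assumes lam: "is_partition lam"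
  defines "p \<equiv> part lam"
  shows "bij_betw (\<lambda>k. part_list (p(k := p k + 1))) {k. k < Suc (length lam) \<and> (k = 0 \<or> p k < p (k - 1))}
    {gam. is_partition gam \<and> lam \<in> T1 gam}"
proof (rule bij_betw_byWitness[where f' = "changed_row lam"])
  have up: "is_partition (part_list (p(k := p k + 1)))" "part (part_list (p(k := p k + 1))) = p(k := p k + 1)"
    if "k = 0 \<or> p k < p (k - 1)" for k
  proof -
    have "(p(k := p k + 1)) (Suc i) \<le> (p(k := p k + 1)) i" for i
      using part_antimono[OF lam, of i "Suc i"] that by (auto simp: p_def)
    moreover have "(p(k := p k + 1)) (Suc (length lam + k)) = 0"
      by (simp add: p_def)
    ultimately show "is_partition (part_list (p(k := p k + 1)))" "part (part_list (p(k := p k + 1))) = p(k := p k + 1)"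
      by (rule part_list)+
  qed
  show "\<forall>k\<in>{k. k < Suc (length lam) \<and> (k = 0 \<or> p k < p (k - 1))}.
      changed_row lam (part_list (p(k := p k + 1))) = k"
    using up by (auto intro!: changed_row_eq simp: p_def)
  show "(\<lambda>k. part_list (p(k := p k + 1))) ` {k. k < Suc (length lam) \<and> (k = 0 \<or> p k < p (k - 1))}
      \<subseteq> {gam. is_partition gam \<and> lam \<in> T1 gam}"
    using up lam by (auto simp: mem_T1_iff) (auto simp: p_def)
  have down: "\<exists>k. part gam = p(k := p k + 1) \<and> k < Suc (length lam) \<and> (k = 0 \<or> p k < p (k - 1))"
    if gam: "is_partition gam" "lam \<in> T1 gam" for gam
  proof -
    obtain k where k: "part gam = p(k := p k + 1)"
      using gam by (auto simp: mem_T1_iff p_def)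
    have 1: "p k < p (k - 1)" if "k \<noteq> 0"
      using fun_cong[OF k, of k] fun_cong[OF k, of "k - 1"] part_antimono[OF gam(1), of "k - 1" k] that
      by (cases k) simp_all
    \<comment> \<open>For \<open>k \<noteq> 0\<close> the row above is strictly longer, hence
      nonempty.\<close>
    then have "k < Suc (length lam)"
      using part_pos_iff[OF lam, of "k - 1"] by (cases k) (auto simp: p_def)
    with k 1 show ?thesis
      by (intro exI[of _ k] conjI) auto
  qed
  show "\<forall>gam\<in>{gam. is_partition gam \<and> lam \<in> T1 gam}.
      part_list (p(changed_row lam gam := p (changed_row lam gam) + 1)) = gam"
  proof
    fix gam assume "gam \<in> {gam. is_partition gam \<and> lam \<in> T1 gam}"
    then obtain k where "is_partition gam" "part gam = p(k := p k + 1)"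
      using down[of gam] by auto
    then show "part_list (p(changed_row lam gam := p (changed_row lam gam) + 1)) = gam"
      using changed_row_eq[of gam lam k] part_list_part[of gam] by (simp add: p_def)
  qed
  show "changed_row lam ` {gam. is_partition gam \<and> lam \<in> T1 gam}
      \<subseteq> {k. k < Suc (length lam) \<and> (k = 0 \<or> p k < p (k - 1))}"
  proof (rule image_subsetI)
    fix gam assume "gam \<in> {gam. is_partition gam \<and> lam \<in> T1 gam}"
    then obtain k where k: "part gam = p(k := p k + 1)" "k < Suc (length lam) \<and> (k = 0 \<or> p k < p (k - 1))"
      using down[of gam] by auto
    then show "changed_row lam gam \<in> {k. k < Suc (length lam) \<and> (k = 0 \<or> p k < p (k - 1))}"
      using changed_row_eq[of gam lam k] by (simp add: p_def)
  qed
qed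

text \<open>A box can leave exactly the rows strictly longer than the next one; the last row
  qualifies because \<open>part\<close> is \<open>0\<close> beyond the length.\<close>

lemma bij_betw_removable_rows:
  assumes gam: "is_partition gam"
  defines "q \<equiv> part gam"
  shows "bij_betw (\<lambda>k. part_list (q(k := q k - 1))) {k. k < length gam \<and> q (Suc k) < q k} (T1 gam)"
proof (rule bij_betw_byWitness[where f' = "\<lambda>lam. changed_row lam gam"])
  have down: "is_partition (part_list (q(k := q k - 1)))" "part (part_list (q(k := q k - 1))) = q(k := q k - 1)"
    if "q (Suc k) < q k" for k
  proof -
    have "(q(k := q k - 1)) (Suc i) \<le> (q(k := q k - 1)) i" for i
      using part_antimono[OF gam, of i "Suc i"] that by (auto simp: q_def)
    moreover have "(q(k := q k - 1)) (Suc (length gam + k)) = 0"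
      by (simp add: q_def)
    ultimately show "is_partition (part_list (q(k := q k - 1)))" "part (part_list (q(k := q k - 1))) = q(k := q k - 1)"
      by (rule part_list)+
  qed
  have row: "part gam = (part (part_list (q(k := q k - 1))))(k := part (part_list (q(k := q k - 1))) k + 1)"
    if "q (Suc k) < q k" for k
    unfolding down(2)[OF that] using that by (auto simp: q_def)
  show "\<forall>k\<in>{k. k < length gam \<and> q (Suc k) < q k}. changed_row (part_list (q(k := q k - 1))) gam = k"
    using row by (auto intro!: changed_row_eq)
  show "(\<lambda>k. part_list (q(k := q k - 1))) ` {k. k < length gam \<and> q (Suc k) < q k} \<subseteq> T1 gam"
    using down row by (auto simp: mem_T1_iff[OF gam])
  have up: "\<exists>k. part gam = (part lam)(k := part lam k + 1) \<and> part lam = q(k := q k - 1)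
      \<and> k < length gam \<and> q (Suc k) < q k" if lam: "lam \<in> T1 gam" for lam
  proof -
    obtain k where k: "is_partition lam" "part gam = (part lam)(k := part lam k + 1)"
      using lam by (auto simp: mem_T1_iff[OF gam])
    then have "part lam = q(k := q k - 1)"
      by (auto simp: q_def)
    \<comment> \<open>Row \<open>Suc k\<close> is the same in \<open>lam\<close> and
      \<open>gam\<close>, and in \<open>lam\<close> it is at most row \<open>k\<close>, which is one
      shorter than in \<open>gam\<close>.\<close>
    moreover have "0 < part gam k" "q (Suc k) < q k"
      using k part_antimono[OF k(1), of k "Suc k"] by (auto simp: q_def)
    ultimately show ?thesis
      using k(2) part_pos_iff[OF gam, of k] by (intro exI[of _ k] conjI) simp_all
  qed
  show "\<forall>lam\<in>T1 gam. part_list (q(changed_row lam gam := q (changed_row lam gam) - 1)) = lam"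
  proof
    fix lam assume lam: "lam \<in> T1 gam"
    then obtain k where k: "part gam = (part lam)(k := part lam k + 1)" "part lam = q(k := q k - 1)"
      using up[OF lam] by (elim exE conjE) (rule that)
    have "is_partition lam"
      using lam by (simp add: T1_def)
    then show "part_list (q(changed_row lam gam := q (changed_row lam gam) - 1)) = lam"
      using changed_row_eq[OF k(1)] part_list_part[of lam] k(2) by simp
  qed
  show "(\<lambda>lam. changed_row lam gam) ` T1 gam \<subseteq> {k. k < length gam \<and> q (Suc k) < q k}"
  proof (rule image_subsetI)
    fix lam assume "lam \<in> T1 gam"
    from up[OF this] obtain k where "part gam = (part lam)(k := part lam k + 1)"
      "k < length gam" "q (Suc k) < q k"
      by (elim exE conjE) (rule that)
    then show "changed_row lam gam \<in> {k. k < length gam \<and> q (Suc k) < q k}"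
      by (simp only: changed_row_eq mem_Collect_eq)
  qed
qed

lemma finite_T1:
  assumes "is_partition gam"
  shows "finite (T1 gam)"
  using bij_betw_finite[OF bij_betw_removable_rows[OF assms]] by simp

section \<open>Schur determinants summed over covering and covered partitions\<close>

text \<open>For \<open>h k\<close> the complete homogeneous symmetric polynomials this is the Schur polynomial.\<close>

definition schur :: "(int \<Rightarrow> 'a :: comm_ring_1) \<Rightarrow> nat list \<Rightarrow> 'a" where
  "schur h lam = jacobi_trudi h (length lam) (part lam)"

lemma schur_eq_jacobi_trudi:
  assumes "\<And>k. k < 0 \<Longrightarrow> h k = 0" "h 0 = 1" "is_partition lam" "part lam m = 0"
  shows "schur h lam = jacobi_trudi h m (part lam)"
proof -
  have "length lam \<le> m"
    using part_pos_iff[OF assms(3), of m] assms(4) by simp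
  then show ?thesis
    unfolding schur_def using assms(1,2) by (intro jacobi_trudi_pad[symmetric]) auto
qed

text \<open>In \<open>pieri_jacobi_trudi\<close> the terms for non-addable rows vanish by equal
  columns \<open>k - 1\<close> and \<open>k\<close>; the others are the covers of
  \<open>lam\<close>, padded to size \<open>Suc ?m\<close>.\<close>

lemma pieri_schur:
  assumes neg: "\<And>k. k < 0 \<Longrightarrow> h k = 0" and "h 0 = 1" and lam: "is_partition lam"
  shows "(\<Sum>gam | is_partition gam \<and> lam \<in> T1 gam. schur h gam) = h 1 * schur h lam"
proof -
  let ?m = "length lam" and ?p = "part lam"
  let ?A = "{k. k < Suc ?m \<and> (k = 0 \<or> ?p k < ?p (k - 1))}"
  let ?g = "\<lambda>k. part_list (?p(k := ?p k + 1))"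
  note bij = bij_betw_addable_rows[OF lam]
  have "jacobi_trudi h (Suc ?m) (?p(k := ?p k + 1)) = 0" if "k < Suc ?m" "k \<notin> ?A" for k
  proof (rule jacobi_trudi_eq_0)
    have "?p k = ?p (k - 1)"
      using that part_antimono[OF lam, of "k - 1" k] by auto
    then show "int ((?p(k := ?p k + 1)) k) - int k = int ((?p(k := ?p k + 1)) (k - 1)) - int (k - 1)"
      using that by (cases k) auto
  qed (use that in auto)
  then have "h 1 * schur h lam = (\<Sum>k\<in>?A. jacobi_trudi h (Suc ?m) (?p(k := ?p k + 1)))"
    unfolding schur_def using pieri_jacobi_trudi[of h ?p ?m, OF neg]
    by (subst sum.mono_neutral_left[of "{..<Suc ?m}" ?A]) auto
  also have "\<dots> = (\<Sum>k\<in>?A. schur h (?g k))"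
  proof (rule sum.cong[OF refl])
    fix k assume k: "k \<in> ?A"
    then have g: "is_partition (?g k)" "lam \<in> T1 (?g k)"
      using bij_betwE[OF bij] by auto
    have "part (?g k) = ?p(k := ?p k + 1)"
    proof (rule part_list(2))
      show "(?p(k := ?p k + 1)) (Suc i) \<le> (?p(k := ?p k + 1)) i" for i
        using part_antimono[OF lam, of i "Suc i"] k by auto
    qed (use k in \<open>auto intro: part_eq_0[of _ "Suc ?m"]\<close>)
    moreover from this have "part (?g k) (Suc ?m) = 0"
      using k by auto
    ultimately show "jacobi_trudi h (Suc ?m) (?p(k := ?p k + 1)) = schur h (?g k)"
      using schur_eq_jacobi_trudi[of h "?g k" "Suc ?m"] assms g by simp
  qed
  also have "\<dots> = (\<Sum>gam | is_partition gam \<and> lam \<in> T1 gam. schur h gam)"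
    by (rule sum.reindex_bij_betw[OF bij])
  finally show ?thesis ..
qed

text \<open>The removal counterpart, from \<open>jacobi_trudi_decrement\<close>: for a non-removable
  row the columns \<open>k\<close> and \<open>Suc k\<close> agree.\<close>

lemma sum_schur_T1:
  fixes e :: "int \<Rightarrow> 'a :: comm_ring_1"
  assumes neg: "\<And>k. k < 0 \<Longrightarrow> e k = 0" and "e 0 = 1" and e: "\<And>k. of_int k * e k = e (k - 1)"
    and gam: "is_partition gam"
  shows "(\<Sum>lam\<in>T1 gam. schur e lam) = of_nat (sum_list gam) * schur e gam"
proof -
  let ?m = "length gam" and ?q = "part gam"
  let ?A = "{k. k < ?m \<and> ?q (Suc k) < ?q k}"
  let ?g = "\<lambda>k. part_list (?q(k := ?q k - 1))"
  note bij = bij_betw_removable_rows[OF gam]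
  have pos: "0 < ?q k" if "k < ?m" for k
    using part_pos_iff[OF gam] that by simp
  have "jacobi_trudi e ?m (?q(k := ?q k - 1)) = 0" if k: "k < ?m" "k \<notin> ?A" for k
  proof (rule jacobi_trudi_eq_0[of k _ "Suc k"])
    have eq: "?q (Suc k) = ?q k"
      using k part_antimono[OF gam, of k "Suc k"] by auto
    \<comment> \<open>Row \<open>Suc k\<close> is as long as the nonempty row \<open>k\<close>, so
      its column does lie in the matrix.\<close>
    then show "Suc k < ?m"
      using pos[OF k(1)] part_pos_iff[OF gam, of "Suc k"] by simp
    show "int ((?q(k := ?q k - 1)) k) - int k = int ((?q(k := ?q k - 1)) (Suc k)) - int (Suc k)"
      using eq pos[OF k(1)] by simp
  qed (use k in auto)
  then have "(\<Sum>k<?m. jacobi_trudi e ?m (?q(k := ?q k - 1))) = (\<Sum>k\<in>?A. jacobi_trudi e ?m (?q(k := ?q k - 1)))"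
    by (intro sum.mono_neutral_right) auto
  then have "of_nat (sum_list gam) * schur e gam = (\<Sum>k\<in>?A. jacobi_trudi e ?m (?q(k := ?q k - 1)))"
    unfolding schur_def sum_list_eq_sum_part[OF order_refl]
    using jacobi_trudi_decrement[of e ?m ?q, OF e pos] by simp
  also have "\<dots> = (\<Sum>k\<in>?A. schur e (?g k))"
  proof (rule sum.cong[OF refl])
    fix k assume k: "k \<in> ?A"
    then have g: "is_partition (?g k)"
      using bij_betwE[OF bij] by (auto simp: T1_def)
    have "part (?g k) = ?q(k := ?q k - 1)"
    proof (rule part_list(2))
      show "(?q(k := ?q k - 1)) (Suc i) \<le> (?q(k := ?q k - 1)) i" for i
        using part_antimono[OF gam, of i "Suc i"] k by auto
    qed (use k in \<open>auto intro: part_eq_0[of _ ?m]\<close>)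
    moreover from this have "part (?g k) ?m = 0"
      using k by auto
    ultimately show "jacobi_trudi e ?m (?q(k := ?q k - 1)) = schur e (?g k)"
      using schur_eq_jacobi_trudi[of e "?g k" ?m] assms g by simp
  qed
  also have "\<dots> = (\<Sum>lam\<in>T1 gam. schur e lam)"
    by (rule sum.reindex_bij_betw[OF bij])
  finally show ?thesis ..
qed

section \<open>Standard tableaux\<close>

lemma mem_cells_iff: "(i, j) \<in> cells lam \<longleftrightarrow> j < part lam i"
  by (auto simp: cells_def part_def)

lemma cells_cover:
  assumes "part gam = (part lam)(k := part lam k + 1)"
  shows "cells gam = insert (k, part lam k) (cells lam)"
  by (auto simp: mem_cells_iff assms less_Suc_eq split: if_splits)

lemma finite_cells: "finite (cells lam)"
proof -
  have "cells lam = Sigma {..<length lam} (\<lambda>i. {..<lam ! i})"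
    by (auto simp: cells_def)
  then show ?thesis by simp
qed

lemma finite_standard_tableaux: "finite (standard_tableaux lam)"
proof (rule finite_subset)
  show "standard_tableaux lam \<subseteq> PiE (cells lam) (\<lambda>_. {1..sum_list lam})"
    by (rule subsetI, rule PiE_I) (auto simp: standard_tableaux_def extensional_def dest: bij_betwE)
qed (simp add: finite_cells finite_PiE)

text \<open>The branching rule: the largest entry sits in a corner, and removing it leaves a
  standard tableau. As columns count from \<open>0\<close>, the new cell of row \<open>k\<close> is
  \<open>(k, part lam k)\<close>.\<close>

lemma bij_betw_add_max_cell:
  assumes gam: "is_partition gam" and "gam \<noteq> []"
  shows "bij_betw (\<lambda>(lam, T). T((changed_row lam gam, part lam (changed_row lam gam)) := sum_list gam))
    (SIGMA lam:T1 gam. standard_tableaux lam) (standard_tableaux gam)"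
    (is "bij_betw ?f ?A ?B")
proof -
  let ?N = "sum_list gam"
  have T1D: "\<exists>k. part gam = (part lam)(k := part lam k + 1) \<and> changed_row lam gam = k
      \<and> cells gam = insert (k, part lam k) (cells lam) \<and> (k, part lam k) \<notin> cells lam \<and> is_partition lam
      \<and> ?N = sum_list lam + 1" if "lam \<in> T1 gam" for lam
  proof -
    obtain k where k: "part gam = (part lam)(k := part lam k + 1)"
      using \<open>lam \<in> T1 gam\<close> mem_T1_iff[OF gam] by auto
    moreover have "is_partition lam" "?N = sum_list lam + 1"
      using \<open>lam \<in> T1 gam\<close> by (auto simp: T1_def)
    ultimately show ?thesis
      using changed_row_eq[OF k] cells_cover[OF k]
      by (intro exI[of _ k]) (simp_all add: mem_cells_iff)
  qed
  have image: "T((k, part lam k) := ?N) \<in> ?B"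
    if k: "part gam = (part lam)(k := part lam k + 1)" "cells gam = insert (k, part lam k) (cells lam)"
      "(k, part lam k) \<notin> cells lam" "is_partition lam" "?N = sum_list lam + 1" and T: "T \<in> standard_tableaux lam"
    for lam k T
  proof -
    let ?T = "T((k, part lam k) := ?N)"
    have bij: "bij_betw T (cells lam) {1..sum_list lam}"
      using T by (simp add: standard_tableaux_def)
    have less: "T c < ?N" if "c \<in> cells lam" for c
      using bij_betwE[OF bij] that k(5) by fastforce
    have "bij_betw ?T (cells lam) {1..sum_list lam}"
      using bij k(3) by (subst bij_betw_cong[of _ _ T]) auto
    then have "bij_betw ?T (cells gam) {1..?N}"
      unfolding k(2) using k(3,5) notIn_Un_bij_betw[of "(k, part lam k)" "cells lam" ?T "{1..sum_list lam}"]
      by (simp add: atLeastAtMostSuc_conv)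
    moreover have "?T \<in> extensional (cells gam)"
      using T unfolding k(2) by (auto simp: standard_tableaux_def extensional_def)
    moreover have "?T (i, j) < ?T (i, j')" if "(i, j) \<in> cells gam" "(i, j') \<in> cells gam" "j < j'" for i j j'
    proof -
      \<comment> \<open>Nothing lies to the right of the new cell, so it can occur only as the
        larger of the two.\<close>
      have *: "(i, j) \<in> cells lam"
        using that by (auto simp: mem_cells_iff k(1) split: if_splits)
      then have "(i, j) \<noteq> (k, part lam k)"
        using k(3) by auto
      then show ?thesis
        using * that T less[OF *] unfolding k(2) standard_tableaux_def by auto
    qed
    moreover have "?T (i, j) < ?T (i', j)" if "(i, j) \<in> cells gam" "(i', j) \<in> cells gam" "i < i'" for i i' j
    proof -
      \<comment> \<open>Likewise nothing lies below the new cell, since \<open>lam\<close> is itself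
        a partition.\<close>
      have *: "(i, j) \<in> cells lam"
        using that part_antimono[OF k(4), of i i'] part_antimono[OF gam, of i i'] unfolding k(1)
        by (auto simp: mem_cells_iff k(1) split: if_splits)
      then have "(i, j) \<noteq> (k, part lam k)"
        using k(3) by auto
      then show ?thesis
        using * that T less[OF *] unfolding k(2) standard_tableaux_def by auto
    qed
    ultimately show ?thesis
      by (auto simp: standard_tableaux_def)
  qed
  have inj: "inj_on ?f ?A"
  proof (rule inj_onI)
    fix a b assume ab: "a \<in> ?A" "b \<in> ?A" "?f a = ?f b"
    obtain lam T lam' T' where a: "a = (lam, T)" and b: "b = (lam', T')"
      by (meson surj_pair)
    have lam: "lam \<in> T1 gam" "lam' \<in> T1 gam" and T: "T \<in> standard_tableaux lam" "T' \<in> standard_tableaux lam'"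
      and eq: "?f (lam, T) = ?f (lam', T')"
      using ab unfolding a b by simp_all
    obtain k where k: "part gam = (part lam)(k := part lam k + 1)" "changed_row lam gam = k"
      "cells gam = insert (k, part lam k) (cells lam)" "(k, part lam k) \<notin> cells lam" "is_partition lam"
      "?N = sum_list lam + 1"
      using T1D[OF lam(1)] by (elim exE conjE) (rule that)
    obtain k' where k': "part gam = (part lam')(k' := part lam' k' + 1)" "changed_row lam' gam = k'"
      "cells gam = insert (k', part lam' k') (cells lam')" "(k', part lam' k') \<notin> cells lam'" "is_partition lam'"
      "?N = sum_list lam' + 1"
      using T1D[OF lam(2)] by (elim exE conjE) (rule that)
    have eq: "T((k, part lam k) := ?N) = T'((k', part lam' k') := ?N)"
      using eq k(2) k'(2) by simp
    have "T((k, part lam k) := ?N) \<in> ?B"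
      by (rule image) (use k T in simp_all)
    then have "inj_on (T((k, part lam k) := ?N)) (cells gam)"
      by (auto simp: standard_tableaux_def bij_betw_def)
    \<comment> \<open>The common tableau takes the value \<open>?N\<close> at both added cells;
      injectivity makes them one cell, which then determines \<open>lam\<close> and
      \<open>T\<close>.\<close>
    moreover have "(T((k, part lam k) := ?N)) (k, part lam k) = (T((k, part lam k) := ?N)) (k', part lam' k')"
      by (subst (2) eq) simp
    moreover have "(k, part lam k) \<in> cells gam" "(k', part lam' k') \<in> cells gam"
      using k(3) k'(3) by blast+
    ultimately have c: "(k, part lam k) = (k', part lam' k')"
      by (rule inj_onD)
    have "part lam = part lam'"
    proof
      fix i
      show "part lam i = part lam' i"
        using fun_cong[OF k(1), of i] fun_cong[OF k'(1), of i] c by (auto split: if_splits)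
    qed
    then have lam_eq: "lam = lam'"
      using k(5) k'(5) by (intro part_inject)
    moreover have "T = T'"
    proof (rule extensionalityI[of _ "cells lam"])
      show "T \<in> extensional (cells lam)" "T' \<in> extensional (cells lam)"
        using T lam_eq by (auto simp: standard_tableaux_def)
      show "T c = T' c" if "c \<in> cells lam" for c
        using fun_cong[OF eq, of c] that k(4) c by (auto split: if_splits)
    qed
    ultimately show "a = b"
      by (simp add: a b)
  qed
  moreover have "?f ` ?A \<subseteq> ?B"
  proof (rule image_subsetI, clarify)
    fix lam T assume lam: "lam \<in> T1 gam" and T: "T \<in> standard_tableaux lam"
    obtain k where k: "part gam = (part lam)(k := part lam k + 1)" "changed_row lam gam = k"
      "cells gam = insert (k, part lam k) (cells lam)" "(k, part lam k) \<notin> cells lam" "is_partition lam"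
      "?N = sum_list lam + 1"
      using T1D[OF lam(1)] by (elim exE conjE) (rule that)
    show "T((changed_row lam gam, part lam (changed_row lam gam)) := ?N) \<in> ?B"
      unfolding k(2) by (rule image) (use k T in simp_all)
  qed
  moreover have "?B \<subseteq> ?f ` ?A"
  proof
    fix T assume T: "T \<in> ?B"
    have bij: "bij_betw T (cells gam) {1..?N}"
      and row: "\<And>i j j'. (i, j) \<in> cells gam \<Longrightarrow> (i, j') \<in> cells gam \<Longrightarrow> j < j' \<Longrightarrow> T (i, j) < T (i, j')"
      and column: "\<And>i i' j. (i, j) \<in> cells gam \<Longrightarrow> (i', j) \<in> cells gam \<Longrightarrow> i < i' \<Longrightarrow> T (i, j) < T (i', j)"
      using T by (auto simp: standard_tableaux_def)
    have le: "T c \<le> ?N" if "c \<in> cells gam" for c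
      using bij_betwE[OF bij] that by auto
    have "1 \<le> ?N"
      using assms by (cases gam) (auto simp: is_partition_def)
    then obtain k c where c: "(k, c) \<in> cells gam" "T (k, c) = ?N"
      using bij_betw_imp_surj_on[OF bij] by (metis atLeastAtMost_iff imageE order_refl surj_pair)
    \<comment> \<open>A cell to the right of the maximum, or below it, would carry an entry above
      \<open>?N\<close>.\<close>
    have "\<not> Suc c < part gam k"
      using row[OF c(1), of "Suc c"] le[of "(k, Suc c)"] c(2) by (auto simp: mem_cells_iff)
    then have ck: "part gam k = Suc c"
      using c(1) by (simp add: mem_cells_iff)
    have "\<not> c < part gam (Suc k)"
      using column[OF c(1), of "Suc k"] le[of "(Suc k, c)"] c(2) by (auto simp: mem_cells_iff)
    then have corner: "part gam (Suc k) < part gam k"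
      using ck by simp
    define lam where "lam = part_list ((part gam)(k := part gam k - 1))"
    have klen: "k < length gam"
      using ck part_pos_iff[OF gam, of k] by simp
    have lam: "lam \<in> T1 gam"
      using bij_betwE[OF bij_betw_removable_rows[OF gam]] klen corner by (auto simp: lam_def)
    have part_lam: "part lam = (part gam)(k := part gam k - 1)"
      unfolding lam_def
    proof (rule part_list(2))
      show "((part gam)(k := part gam k - 1)) (Suc i) \<le> ((part gam)(k := part gam k - 1)) i" for i
        using part_antimono[OF gam, of i "Suc i"] corner by auto
      show "((part gam)(k := part gam k - 1)) (length gam) = 0"
        using klen by simp
    qed
    have gam_eq: "part gam = (part lam)(k := part lam k + 1)"
      unfolding part_lam using ck by auto
    have ck': "c = part lam k"
      using ck by (simp add: part_lam)
    note changed = changed_row_eq[OF gam_eq] and cells = cells_cover[OF gam_eq]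
    have notin: "(k, part lam k) \<notin> cells lam"
      by (simp add: mem_cells_iff)
    \<comment> \<open>Restriction resets the removed cell to \<open>undefined\<close>, as
      \<open>extensional (cells lam)\<close> requires.\<close>
    define T' where "T' = restrict T (cells lam)"
    have "?N = sum_list lam + 1"
      using lam by (simp add: T1_def)
    have "bij_betw T (cells gam - {(k, c)}) ({1..?N} - {T (k, c)})"
      using c(1) bij bij_betwE[OF bij] by (intro bij_betw_DiffI bij_betw_singletonI) auto
    then have "bij_betw T (cells lam) {1..sum_list lam}"
      using notin \<open>?N = sum_list lam + 1\<close> c(2) unfolding cells ck'
      by (simp add: atLeastAtMostSuc_conv)
    then have "bij_betw T' (cells lam) {1..sum_list lam}"
      by (subst bij_betw_cong[of _ _ T]) (auto simp: T'_def)
    moreover have "cells lam \<subseteq> cells gam"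
      unfolding cells by blast
    ultimately have "T' \<in> standard_tableaux lam"
      using row column by (auto simp: standard_tableaux_def T'_def subset_iff)
    moreover have "T = ?f (lam, T')"
    proof (rule extensionalityI[of _ "cells gam"])
      show "T \<in> extensional (cells gam)"
        using T by (simp add: standard_tableaux_def)
      show "?f (lam, T') \<in> extensional (cells gam)"
        by (auto simp: cells changed T'_def extensional_def)
      show "T x = ?f (lam, T') x" if "x \<in> cells gam" for x
        using that c(2) by (auto simp: cells changed T'_def ck')
    qed
    ultimately show "T \<in> ?f ` ?A"
      using lam by (intro image_eqI[of _ _ "(lam, T')"]) auto
  qed
  ultimately show ?thesis
    by (simp add: bij_betw_def subset_antisym)
qed

lemma num_SYT_eq_sum_T1:
  assumes "is_partition gam" "gam \<noteq> []"
  shows "num_SYT gam = (\<Sum>lam\<in>T1 gam. num_SYT lam)"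
  using bij_betw_same_card[OF bij_betw_add_max_cell[OF assms]] finite_T1[OF assms(1)]
  by (simp add: num_SYT_def card_SigmaI finite_standard_tableaux)

section \<open>The exponential specialisation and the number of standard tableaux\<close>

definition inv_fact :: "int \<Rightarrow> real" where
  "inv_fact k = (if k < 0 then 0 else 1 / fact (nat k))"

text \<open>The extension by zero makes this hold at every integer; at \<open>k = 0\<close> both
  sides are \<open>0\<close>.\<close>

lemma of_int_mult_inv_fact: "of_int k * inv_fact k = inv_fact (k - 1)"
proof (cases "0 < k")
  case True
  then have "nat k = Suc (nat (k - 1))"
    by simp
  then have "(fact (nat k) :: real) = of_int k * fact (nat (k - 1))"
    using True by simp
  then show ?thesis
    using True by (simp add: inv_fact_def)
qed (auto simp: inv_fact_def)

text \<open>Aitken's determinant formula. In the induction step the factor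
  \<open>sum_list lam\<close> from \<open>sum_schur_T1\<close> turns \<open>fact n\<close> into
  \<open>fact (Suc n)\<close>.\<close>

lemma num_SYT_eq_schur:
  assumes "is_partition lam"
  shows "real (num_SYT lam) = fact (sum_list lam) * schur inv_fact lam"
  using assms
proof (induction "sum_list lam" arbitrary: lam)
  case 0
  then have "lam = []"
    by (cases lam) (auto simp: is_partition_def)
  \<comment> \<open>The only function extensional on the empty set is \<open>undefined\<close>
    everywhere.\<close>
  then have "standard_tableaux lam = {\<lambda>_. undefined}"
    by (auto simp: standard_tableaux_def cells_def bij_betw_def)
  then show ?case
    using \<open>lam = []\<close> by (simp add: num_SYT_def schur_def jacobi_trudi_def)
next
  case (Suc n)
  have "real (num_SYT lam) = (\<Sum>mu\<in>T1 lam. real (num_SYT mu))"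
    using Suc by (subst num_SYT_eq_sum_T1) auto
  also have "\<dots> = (\<Sum>mu\<in>T1 lam. fact n * schur inv_fact mu)"
  proof (rule sum.cong[OF refl])
    fix mu assume "mu \<in> T1 lam"
    then have "n = sum_list mu" "is_partition mu"
      using Suc(2) by (auto simp: T1_def)
    then show "real (num_SYT mu) = fact n * schur inv_fact mu"
      using Suc(1)[of mu] by simp
  qed
  also have "\<dots> = fact n * (of_nat (sum_list lam) * schur inv_fact lam)"
    unfolding sum_distrib_left[symmetric]
    using of_int_mult_inv_fact Suc(3) by (subst sum_schur_T1) (auto simp: inv_fact_def)
  finally show ?case
    by (simp add: Suc(2)[symmetric])
qed

section \<open>Wronskian Hermite polynomials\<close>

text \<open>The Appell property, obtained by differentiating the recurrence; two earlier cases are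
  needed, hence strong induction.\<close>

lemma pderiv_hermite: "pderiv (hermite (Suc n)) = of_nat (Suc n) * hermite n"
proof (induction n rule: less_induct)
  case (less n)
  consider "n = 0" | "n = 1" | k where "n = Suc (Suc k)"
    by (metis One_nat_def not0_implies_Suc)
  then show ?case
  proof cases
    case 1
    then show ?thesis by (simp add: pderiv_pCons)
  next
    case 2
    then show ?thesis by (simp add: pderiv_pCons pderiv_diff pderiv_mult numeral_poly)
  next
    case 3
    have "pderiv (hermite (Suc n)) = hermite n + [:0, 1:] * (of_nat n * hermite (Suc k))
        - of_nat n * (of_nat (Suc k) * hermite k)"
      using less[of "Suc k"] less[of k] 3 by (simp add: pderiv_diff pderiv_mult pderiv_pCons del: of_nat_Suc)
    \<comment> \<open>Factoring out \<open>n\<close> leaves the recurrence that defines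
      \<open>hermite n\<close>.\<close>
    also have "\<dots> = hermite n + of_nat n * ([:0, 1:] * hermite (Suc k) - of_nat (Suc k) * hermite k)"
      by (simp add: algebra_simps del: of_nat_Suc)
    also have "[:0, 1:] * hermite (Suc k) - of_nat (Suc k) * hermite k = hermite n"
      using 3 by simp
    finally show ?thesis
      by (simp add: algebra_simps)
  qed
qed

text \<open>Zero at negative indices, so that differentiation is a plain index shift even for the
  constant at \<open>k = 0\<close>.\<close>

definition divided_hermite :: "int \<Rightarrow> real poly" where
  "divided_hermite k = (if k < 0 then 0 else smult (1 / fact (nat k)) (hermite (nat k)))"

lemma pderiv_divided_hermite: "pderiv (divided_hermite k) = divided_hermite (k - 1)"
proof (cases "0 < k")
  case True
  define n where "n = nat (k - 1)"
  have "nat k = Suc n"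
    using True by (simp add: n_def)
  moreover have "real (Suc n) / fact (Suc n) = 1 / fact n"
    by (simp del: of_nat_Suc)
  ultimately show ?thesis
    using True n_def
    by (simp add: divided_hermite_def pderiv_smult pderiv_hermite of_nat_poly del: of_nat_Suc fact_Suc)
next
  case False
  then show ?thesis
    by (cases "k = 0") (auto simp: divided_hermite_def pderiv_smult)
qed

lemma higher_pderiv_hermite:
  "(pderiv ^^ i) (hermite n) = smult (fact n) (divided_hermite (int n - int i))"
proof (induction i)
  case (Suc i)
  then show ?case
    by (simp add: pderiv_smult pderiv_divided_hermite algebra_simps)
qed (simp add: divided_hermite_def)

text \<open>With \<open>m = length lam\<close> the degrees are
  \<open>part lam j + m - 1 - j\<close>, so reading row \<open>i\<close> as row
  \<open>m - 1 - i\<close> gives the Jacobi-Trudi entries. Generic in \<open>h\<close>, to serve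
  Wronskian and Vandermonde alike.\<close>

lemma det_degree_seq:
  fixes h :: "int \<Rightarrow> 'a :: comm_ring_1"
  shows "det (mat (length lam) (length lam) (\<lambda>(i, j). h (int (degree_seq lam ! j) - int i)))
    = of_int (sign (rev_rows (length lam))) * schur h lam"
proof -
  let ?m = "length lam"
  let ?M = "\<lambda>i j. h (int (part lam j) - int j + int i)"
  have "mat ?m ?m (\<lambda>(i, j). h (int (degree_seq lam ! j) - int i)) = mat ?m ?m (\<lambda>(i, j). ?M (?m - Suc i) j)"
    by (intro eq_matI) (auto simp: degree_seq_def part_def of_nat_diff algebra_simps)
  then show ?thesis
    unfolding schur_def jacobi_trudi_def
    using det_mat_reverse_rows[of ?m ?M] by simp
qed

text \<open>The falling factorial \<open>n! / (n - i)!\<close>; for \<open>i > n\<close> both sides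
  are \<open>0\<close>.\<close>

lemma poly_falling_factorial:
  "poly (\<Prod>k<i. [:- of_nat k, 1:]) (real n) = fact n * inv_fact (int n - int i)"
proof (induction i)
  case (Suc i)
  have "(real n - real i) * inv_fact (int n - int i) = inv_fact (int n - int (Suc i))"
    using of_int_mult_inv_fact[of "int n - int i"] by (simp add: algebra_simps)
  then show ?case
    using Suc by (simp add: algebra_simps)
qed (simp add: inv_fact_def)

text \<open>The falling factorials are monic of degree \<open>i\<close>, so their values at the
  nodes have the Vandermonde product as determinant.\<close>

lemma vandermonde_eq_det:
  "vandermonde ns = (\<Prod>j<length ns. fact (ns ! j))
    * det (mat (length ns) (length ns) (\<lambda>(i, j). inv_fact (int (ns ! j) - int i)))"
proof -
  have "vandermonde ns = det (mat (length ns) (length ns)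
      (\<lambda>(i, j). poly (\<Prod>k<i. [:- of_nat k, 1:]) (real (ns ! j))))"
    unfolding vandermonde_def
    by (rule det_mat_monic_polys[symmetric]) (simp_all add: monic_prod_linear)
  then show ?thesis
    by (simp only: poly_falling_factorial det_mat_scale_cols)
qed

lemma wronskian_hermite_eq_det:
  "wronskian (map hermite ns) = smult (\<Prod>j<length ns. fact (ns ! j))
    (det (mat (length ns) (length ns) (\<lambda>(i, j). divided_hermite (int (ns ! j) - int i))))"
proof -
  have "wronskian (map hermite ns) = det (mat (length ns) (length ns)
      (\<lambda>(i, j). [:fact (ns ! j):] * divided_hermite (int (ns ! j) - int i)))"
    unfolding wronskian_def
    by (intro arg_cong[of _ _ det] eq_matI) (auto simp: higher_pderiv_hermite)
  also have "\<dots> = (\<Prod>j<length ns. [:fact (ns ! j):])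
      * det (mat (length ns) (length ns) (\<lambda>(i, j). divided_hermite (int (ns ! j) - int i)))"
    by (rule det_mat_scale_cols)
  also have "(\<Prod>j<k. [:fact (ns ! j) :: real:]) = [:\<Prod>j<k. fact (ns ! j):]" for k
    by (induction k) (simp_all add: one_pCons mult.commute)
  finally show ?thesis by simp
qed

text \<open>The degree sequence is strictly decreasing. This justifies the division in
  \<open>wronskian_hermite\<close>.\<close>

lemma vandermonde_degree_seq_nonzero:
  assumes "is_partition lam"
  shows "vandermonde (degree_seq lam) \<noteq> 0"
proof -
  have "degree_seq lam ! j < degree_seq lam ! i" if "i < j" "j < length lam" for i j
    using part_antimono[OF assms, of i j] that by (simp add: degree_seq_def part_def)
  then show ?thesis
    by (fastforce simp: vandermonde_def degree_seq_def)
qed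

lemma num_SYT_wronskian_hermite:
  assumes "is_partition lam"
  shows "of_nat (num_SYT lam) * wronskian_hermite lam = smult (fact (sum_list lam)) (schur divided_hermite lam)"
proof -
  let ?ns = "degree_seq lam"
  define s where "s = sign (rev_rows (length lam))"
  define P :: real where "P = (\<Prod>j<length ?ns. fact (?ns ! j))"
  have len: "length ?ns = length lam"
    by (simp add: degree_seq_def)
  have V: "vandermonde ?ns = P * (of_int s * schur inv_fact lam)"
    unfolding vandermonde_eq_det P_def s_def using det_degree_seq[of lam inv_fact] by (simp add: len)
  have W: "wronskian (map hermite ?ns) = smult P (of_int s * schur divided_hermite lam)"
    unfolding wronskian_hermite_eq_det P_def s_def using det_degree_seq[of lam divided_hermite] by (simp add: len)
  have "of_nat (num_SYT lam) * wronskian_hermite lam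
      = smult (real (num_SYT lam) / vandermonde ?ns) (wronskian (map hermite ?ns))"
    by (simp add: wronskian_hermite_def of_nat_poly)
  also have "\<dots> = smult (real (num_SYT lam) / vandermonde ?ns * P * of_int s) (schur divided_hermite lam)"
    by (simp add: W of_int_poly mult.assoc)
  \<comment> \<open>By \<open>V\<close>, a nonzero Vandermonde product means that \<open>P\<close>,
    the sign and \<open>schur inv_fact lam\<close> are all nonzero, so they cancel.\<close>
  also have "real (num_SYT lam) / vandermonde ?ns * P * of_int s = fact (sum_list lam)"
    using vandermonde_degree_seq_nonzero[OF assms] num_SYT_eq_schur[OF assms] by (auto simp: V)
  finally show ?thesis .
qed

theorem theorem3p2:
  fixes lam :: "nat list"
  assumes "is_partition lam"
  shows "[:0, 1:] * of_nat (sum_list lam + 1) * of_nat (num_SYT lam) * wronskian_hermite lam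
       = (\<Sum>gam | is_partition gam \<and> lam \<in> T1 gam. of_nat (num_SYT gam) * wronskian_hermite gam)"
proof -
  let ?G = "{gam. is_partition gam \<and> lam \<in> T1 gam}"
  have "[:0, 1:] * of_nat (sum_list lam + 1) * of_nat (num_SYT lam) * wronskian_hermite lam
      = [:0, 1:] * (of_nat (sum_list lam + 1) * smult (fact (sum_list lam)) (schur divided_hermite lam))"
    using num_SYT_wronskian_hermite[OF assms] by (simp only: mult.assoc)
  \<comment> \<open>Here \<open>x\<close> is recognised as \<open>divided_hermite 1\<close>, and the
    size factor is absorbed into the factorial.\<close>
  also have "\<dots> = smult (fact (sum_list lam + 1)) (divided_hermite 1 * schur divided_hermite lam)"
    by (simp add: divided_hermite_def of_nat_poly algebra_simps)
  also have "\<dots> = smult (fact (sum_list lam + 1)) (\<Sum>gam\<in>?G. schur divided_hermite gam)"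
    by (subst pieri_schur) (simp_all add: assms divided_hermite_def)
  also have "\<dots> = (\<Sum>gam\<in>?G. smult (fact (sum_list lam + 1)) (schur divided_hermite gam))"
    using sum_distrib_left[of "[:fact (sum_list lam + 1):]" "schur divided_hermite" ?G] by simp
  also have "\<dots> = (\<Sum>gam\<in>?G. of_nat (num_SYT gam) * wronskian_hermite gam)"
  proof (rule sum.cong[OF refl])
    fix gam assume "gam \<in> ?G"
    \<comment> \<open>All covers have the same size, so one factorial fits every term.\<close>
    then have "is_partition gam" "sum_list lam + 1 = sum_list gam"
      by (auto simp: T1_def)
    then show "smult (fact (sum_list lam + 1)) (schur divided_hermite gam) = of_nat (num_SYT gam) * wronskian_hermite gam"
      by (simp only: num_SYT_wronskian_hermite)
  qed
  finally show ?thesis .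
qed

end
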